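(* Let $N\ge 1$ be the number of requests in a batch, $C\ge 1$ the capacity and $T\ge 1$ the number of steps. Assume that for each request $i\in\{1,\dots,N\}$ all tokens of the $i$-th sequence have an identical acceptance rate $\alpha_i\in[0,1]$ (at every position and in every step). Assume drafting takes no time, so that the step time $\tau_{\text{step}}>0$ is a fixed constant. Then: (1) The strategy that at each of the $T$ steps selects the set of draft tokens returned by the TETRIS algorithm (run with the true acceptance rates $p_{i,j}=\alpha_i$) achieves the optimal, i.e. maximal, total throughput $\mathcal{G}$ among all draft token selection strategies with the same capacity $C$ per step. (2) Moreover, if $\alpha_1=\alpha_2=\cdots=\alpha_N$, then the total throughput $\mathcal{G}$ of TETRIS equals that of standard batched speculative decoding with the same capacity.
   Context: Setting (batch speculative decoding over $T$ steps). In each step, for each request $i$ a draft model produces a sequence of draft tokens indexed $(i,1),(i,2),\dots$ (positions counted from the last verified token; enough draft tokens are available that the algorithm below never runs out). The server verifies exactly $C$ draft tokens per step. Feasible selection in a step: a set $\mathcal{D}=\{(i,t): 1\le i\le N,\ 1\le t\le k_i\}$ with integers $k_i\ge 0$ and $\sum_{i=1}^N k_i = C$. A draft token selection strategy with capacity $C$ chooses a feasible selection at each step (possibly depending on the outcomes of earlier steps). Acceptance: $\mathbf{1}_{i,t}$ is the indicator that draft token $(i,t)$ is accepted in the step. A token can be accepted only if all earlier draft tokens of the same request in that step are accepted, and, given this, it is accepted with probability equal to its acceptance rate. With identical rate $\alpha_i$ for all tokens of request $i$, regardless of which tokens were accepted in earlier steps, $\mathbb{E}[\mathbf{1}_{i,t}]=\alpha_i^{t}$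 in each step. Per-step throughput: $\mathcal{G}_{\text{step}} = \big(\mathbb{E}\big[\sum_{(i,t)\in\mathcal{D}}\mathbf{1}_{i,t}\big]+N\big)/\tau_{\text{step}}$, where $\mathcal{D}$ is the selection made in that step and $N$ accounts for one bonus token per request. Total throughput: $\mathcal{G}$ is the average over the $T$ steps of the per-step throughputs, $\mathcal{G}=T^{-1}\sum_{s=1}^{T}\mathcal{G}_{\text{step}}^{(s)}$, with $\mathcal{G}_{\text{step}}^{(s)}$ the per-step throughput of step $s$. TETRIS algorithm (inputs: numbers $p_{i,j}\in[0,1]$, batch size $N$, capacity $C$). Let $\mathcal{B}_{i,j} = (i,j,\prod_{t=1}^{j}p_{i,t})$. Start with $\mathcal{D}^*=\emptyset$ and a max-heap, keyed by the third component, containing $\mathcal{B}_{i,1}$ for every $i\in\{1,\dots,N\}$. Repeat until $|\mathcal{D}^*| = C$: extract from the heap an entry $(i,j,\cdot)$ with the largest key (ties broken arbitrarily), add $(i,j)$ to $\mathcal{D}^*$, and insert $\mathcal{B}_{i,j+1}$ into the heap. Return $\mathcal{D}^*$. Standard batched speculative decoding uses the same fixed draft window size $k$ for every request in every step, i.e. $k_1=\cdots=k_N=k$; having the same capacity as TETRIS means $Nk=C$. *)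

theory Defs
  imports "HOL-Probability.Probability"
begin

type_synonym selection = "(nat \<times> nat) set"

text \<open>Requests are numbered from 1 to \<open>N\<close>, draft positions from 1 and steps from 1 to \<open>T\<close>.\<close>

definition prefix_selection :: "nat \<Rightarrow> (nat \<Rightarrow> nat) \<Rightarrow> selection" where
  "prefix_selection N k = {(i, t). 1 \<le> i \<and> i \<le> N \<and> 1 \<le> t \<and> t \<le> k i}"

definition feasible_selection :: "nat \<Rightarrow> nat \<Rightarrow> selection \<Rightarrow> bool" where
  "feasible_selection N C S \<longleftrightarrow> (\<exists>k. S = prefix_selection N k \<and> (\<Sum>i = 1..N. k i) = C)"

text \<open>
  \<open>acc s i t \<omega>\<close> says that draft token \<open>(i, t)\<close> of step \<open>s\<close> is accepted (were it verified), and
  \<open>F s\<close> is the information available when the selection of step \<open>s\<close> is made. It contains the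
  outcomes of all steps before \<open>s\<close> (\<open>acc_known\<close>) and possibly more, such as a randomisation of
  the strategy. No independence between different requests is required. In \<open>acceptance\<close> the
  event \<open>A\<close> ranges over everything that may have been observed before step \<open>s\<close>; the condition
  on the positions before \<open>t\<close> is empty for \<open>t = 1\<close>. The positivity premise is needed because a
  conditional probability given a null event is 0 by convention.
\<close>

locale draft_model = prob_space M + filtration "space M" F
  for M :: "'w measure" and F :: "nat \<Rightarrow> 'w measure" +
  fixes acc :: "nat \<Rightarrow> nat \<Rightarrow> nat \<Rightarrow> 'w \<Rightarrow> bool"
    and N T :: nat
    and rate :: "nat \<Rightarrow> nat \<Rightarrow> nat \<Rightarrow> real"
  assumes information: "\<And>s. subalgebra M (F s)"
    and acc_known: "\<And>s i t. s \<in> {1..T} \<Longrightarrow> i \<in> {1..N} \<Longrightarrow> 1 \<le> t \<Longrightarrow>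
          Measurable.pred (F (Suc s)) (acc s i t)"
    and acc_prefix: "\<And>s i r t \<omega>. s \<in> {1..T} \<Longrightarrow> i \<in> {1..N} \<Longrightarrow> 1 \<le> r \<Longrightarrow> r \<le> t \<Longrightarrow>
          \<omega> \<in> space M \<Longrightarrow> acc s i t \<omega> \<Longrightarrow> acc s i r \<omega>"
    and acceptance: "\<And>s i t A. s \<in> {1..T} \<Longrightarrow> i \<in> {1..N} \<Longrightarrow> 1 \<le> t \<Longrightarrow> A \<in> sets (F s) \<Longrightarrow>
          \<P>(\<omega> in M. \<omega> \<in> A \<and> (\<forall>r\<in>{1..<t}. acc s i r \<omega>)) > 0 \<Longrightarrow>
          \<P>(\<omega> in M. acc s i t \<omega> \<bar> \<omega> \<in> A \<and> (\<forall>r\<in>{1..<t}. acc s i r \<omega>)) = rate s i t"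

text \<open>
  A strategy is a selection process \<open>D s \<omega>\<close>. The target space of the measurability condition
  also enforces that every selection is feasible.
\<close>

definition strategy ::
    "(nat \<Rightarrow> 'w measure) \<Rightarrow> nat \<Rightarrow> nat \<Rightarrow> nat \<Rightarrow> (nat \<Rightarrow> 'w \<Rightarrow> selection) \<Rightarrow> bool" where
  "strategy F N C T D \<longleftrightarrow>
     (\<forall>s\<in>{1..T}. D s \<in> F s \<rightarrow>\<^sub>M count_space {S. feasible_selection N C S})"

definition step_throughput ::
    "'w measure \<Rightarrow> (nat \<Rightarrow> nat \<Rightarrow> nat \<Rightarrow> 'w \<Rightarrow> bool) \<Rightarrow> nat \<Rightarrow> real \<Rightarrow>
     (nat \<Rightarrow> 'w \<Rightarrow> selection) \<Rightarrow> nat \<Rightarrow> real" where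
  "step_throughput M acc N \<tau> D s =
     ((\<integral>\<omega>. (\<Sum>(i, t)\<in>D s \<omega>. of_bool (acc s i t \<omega>)) \<partial>M) + real N) / \<tau>"

definition total_throughput ::
    "'w measure \<Rightarrow> (nat \<Rightarrow> nat \<Rightarrow> nat \<Rightarrow> 'w \<Rightarrow> bool) \<Rightarrow> nat \<Rightarrow> nat \<Rightarrow> real \<Rightarrow>
     (nat \<Rightarrow> 'w \<Rightarrow> selection) \<Rightarrow> real" where
  "total_throughput M acc N T \<tau> D = (\<Sum>s = 1..T. step_throughput M acc N \<tau> D s) / real T"

type_synonym heap_entry = "nat \<times> nat \<times> real"

definition heap_entry :: "(nat \<Rightarrow> nat \<Rightarrow> real) \<Rightarrow> nat \<Rightarrow> nat \<Rightarrow> heap_entry" where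
  "heap_entry p i j = (i, j, \<Prod>t = 1..j. p i t)"

text \<open>
  \<open>tetris_state p N C S H\<close>: some run of the loop reaches the selection \<open>S\<close> with heap contents
  \<open>H\<close>. Ties are broken nondeterministically. No entry occurs twice in the heap, so a set
  suffices.
\<close>

inductive tetris_state ::
    "(nat \<Rightarrow> nat \<Rightarrow> real) \<Rightarrow> nat \<Rightarrow> nat \<Rightarrow> selection \<Rightarrow> heap_entry set \<Rightarrow> bool"
  for p :: "nat \<Rightarrow> nat \<Rightarrow> real" and N C :: nat where
  init: "tetris_state p N C {} ((\<lambda>i. heap_entry p i 1) ` {1..N})"
| pop_max: "tetris_state p N C S H \<Longrightarrow> card S \<noteq> C \<Longrightarrow>
     (i, j, v) \<in> H \<Longrightarrow> (\<forall>(i', j', v')\<in>H. v' \<le> v) \<Longrightarrow>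
     tetris_state p N C (insert (i, j) S) (insert (heap_entry p i (j + 1)) (H - {(i, j, v)}))"

definition tetris_output ::
    "(nat \<Rightarrow> nat \<Rightarrow> real) \<Rightarrow> nat \<Rightarrow> nat \<Rightarrow> selection \<Rightarrow> bool" where
  "tetris_output p N C S \<longleftrightarrow> (\<exists>H. tetris_state p N C S H) \<and> card S = C"

text \<open>
  The tie-breaking may vary from step to step and depend on past outcomes, but not on the
  outcome of the current step or of later ones.
\<close>

definition tetris_strategy ::
    "(nat \<Rightarrow> 'w measure) \<Rightarrow> (nat \<Rightarrow> nat \<Rightarrow> real) \<Rightarrow> nat \<Rightarrow> nat \<Rightarrow> nat \<Rightarrow>
     (nat \<Rightarrow> 'w \<Rightarrow> selection) \<Rightarrow> bool" where
  "tetris_strategy F p N C T D \<longleftrightarrow>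
     (\<forall>s\<in>{1..T}. D s \<in> F s \<rightarrow>\<^sub>M count_space {S. tetris_output p N C S})"

definition batched_strategy :: "nat \<Rightarrow> nat \<Rightarrow> nat \<Rightarrow> 'w \<Rightarrow> selection" where
  "batched_strategy N k = (\<lambda>s \<omega>. prefix_selection N (\<lambda>i. k))"

end

theory Submission
  imports Defs
begin

text \<open>
  Since a selection is made from information available before the step, a verified token
  \<open>(i, t)\<close> contributes \<open>\<alpha> i ^ t\<close> in expectation, even conditionally on the selection. So every
  strategy earns the expected total weight of its selection, with weights \<open>\<alpha> i ^ t\<close>. TETRIS only
  leaves out tokens that weigh at most as much as each token it takes, hence by exchange its
  selection is heaviest for its cardinality, whatever the outcome. If all rates agree, the same
  exchange property holds for the batched selection.
\<close>

section \<open>Exchange argument and monotone products\<close>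

text \<open>\<open>A - B\<close> and \<open>B - A\<close> have equally many elements, and the
  largest weight in \<open>B - A\<close> is a threshold below which no weight in
  \<open>A - B\<close> falls. Both partial sums are compared with that threshold times the common
  cardinality.\<close>

lemma sum_le_sum_of_dominant:
  fixes w :: "'a \<Rightarrow> 'b::linordered_idom"
  assumes fin: "finite A" "finite B" and card: "card A = card B"
    and dom: "\<And>a b. a \<in> A - B \<Longrightarrow> b \<in> B - A \<Longrightarrow> w b \<le> w a"
  shows "sum w B \<le> sum w A"
proof -
  have cards: "card (B - A) = card (A - B)"
    using card_Diff_subset_Int[of A B] card_Diff_subset_Int[of B A] fin card
    by (simp add: Int_commute)
  have "sum w (B - A) \<le> sum w (A - B)"
  proof (cases "B - A = {}")
    case True
    then have "A - B = {}"
      using cards fin by (metis card_0_eq card.empty finite_Diff)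
    with True show ?thesis by simp
  next
    case False
    define m where "m = Max (w ` (B - A))"
    have "m \<in> w ` (B - A)"
      unfolding m_def using False fin by (intro Max_in) auto
    then have lower: "m \<le> w a" if "a \<in> A - B" for a
      using dom that by auto
    have "sum w (B - A) \<le> of_nat (card (B - A)) * m"
      unfolding m_def using fin by (intro sum_bounded_above Max_ge) auto
    also have "\<dots> \<le> sum w (A - B)"
      unfolding cards using lower by (intro sum_bounded_below)
    finally show ?thesis .
  qed
  moreover have "sum w B = sum w (B \<inter> A) + sum w (B - A)"
    using fin by (metis sum.Int_Diff)
  moreover have "sum w A = sum w (A \<inter> B) + sum w (A - B)"
    using fin by (metis sum.Int_Diff)
  ultimately show ?thesis by (simp add: Int_commute)
qed

lemma prod_unit_interval_antimono:
  fixes f :: "nat \<Rightarrow> 'a::linordered_idom"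
  assumes f: "\<And>i. f i \<in> {0..1}" and "m \<le> n"
  shows "(\<Prod>i = 1..n. f i) \<le> (\<Prod>i = 1..m. f i)"
  using \<open>m \<le> n\<close>
proof (induction rule: dec_induct)
  case (step n)
  have "0 \<le> (\<Prod>i = 1..n. f i)"
    using f by (intro prod_nonneg) auto
  then have "(\<Prod>i = 1..n. f i) * f (Suc n) \<le> (\<Prod>i = 1..n. f i)"
    using f[of "Suc n"] by (intro mult_left_le) auto
  with step.IH show ?case by simp
qed simp

section \<open>Feasible selections\<close>

lemma prefix_selection_eq_Sigma: "prefix_selection N k = (SIGMA i:{1..N}. {1..k i})"
  by (auto simp: prefix_selection_def)

lemma finite_prefix_selection: "finite (prefix_selection N k)"
  by (simp add: prefix_selection_eq_Sigma)

lemma card_prefix_selection: "card (prefix_selection N k) = (\<Sum>i = 1..N. k i)"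
  by (simp add: prefix_selection_eq_Sigma)

lemma feasible_selection_finite: "feasible_selection N C S \<Longrightarrow> finite S"
  by (auto simp: feasible_selection_def finite_prefix_selection)

lemma feasible_selection_card: "feasible_selection N C S \<Longrightarrow> card S = C"
  by (auto simp: feasible_selection_def card_prefix_selection)

text \<open>Supplies a finite box of tokens that does not depend on the outcome, so that sums over a
  random selection can become sums over a fixed set.\<close>

lemma feasible_selection_subset:
  assumes "feasible_selection N C S"
  shows "S \<subseteq> {1..N} \<times> {1..C}"
proof -
  obtain k where S: "S = prefix_selection N k" and C: "(\<Sum>i = 1..N. k i) = C"
    using assms by (auto simp: feasible_selection_def)
  have "k i \<le> C" if "i \<in> {1..N}" for i
    unfolding C[symmetric] using that by (intro member_le_sum) auto
  then show ?thesis
    by (fastforce simp: S prefix_selection_def)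
qed

section \<open>The greedy loop of TETRIS\<close>

text \<open>The heap is the frontier: the first unselected token of each request. A popped token
  dominates the frontier because it is a maximum of the heap; it keeps doing so because factors in
  the unit interval can only lower the products as the frontier advances.\<close>

lemma tetris_state_invariant:
  assumes "tetris_state p N C S H" and p: "\<And>i j. i \<in> {1..N} \<Longrightarrow> p i j \<in> {0..1::real}"
  shows "\<exists>k. S = prefix_selection N k \<and> H = (\<lambda>i. heap_entry p i (k i + 1)) ` {1..N} \<and>
    (\<forall>(i, t)\<in>S. \<forall>i'\<in>{1..N}. (\<Prod>r = 1..k i' + 1. p i' r) \<le> (\<Prod>r = 1..t. p i r))"
  using assms(1)
proof induction
  case init
  show ?case
    by (rule exI[of _ "\<lambda>_. 0"]) (auto simp: prefix_selection_def)
next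
  case (pop_max S H i j v)
  then obtain k where S: "S = prefix_selection N k"
    and H: "H = (\<lambda>i. heap_entry p i (k i + 1)) ` {1..N}"
    and dom: "\<And>i t i'. (i, t) \<in> S \<Longrightarrow> i' \<in> {1..N} \<Longrightarrow>
      (\<Prod>r = 1..k i' + 1. p i' r) \<le> (\<Prod>r = 1..t. p i r)"
    by blast
  have i: "i \<in> {1..N}" and j: "j = k i + 1" and v: "v = (\<Prod>r = 1..j. p i r)"
    using pop_max.hyps(3) by (auto simp: H heap_entry_def)
  have popped_max: "(\<Prod>r = 1..k i' + 1. p i' r) \<le> v" if "i' \<in> {1..N}" for i'
    using pop_max.hyps(4) that by (auto simp: H heap_entry_def)
  define k' where "k' = k(i := j)"
  have "insert (i, j) S = prefix_selection N k'"
    using i by (auto simp: S k'_def j prefix_selection_def le_Suc_eq split: if_splits)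
  moreover have "insert (heap_entry p i (j + 1)) (H - {(i, j, v)})
      = (\<lambda>i. heap_entry p i (k' i + 1)) ` {1..N}"
  proof -
    \<comment> \<open>An entry carries its request number, so removing the popped one removes
      exactly the image of \<open>i\<close>.\<close>
    have "H - {(i, j, v)} = (\<lambda>a. heap_entry p a (k a + 1)) ` ({1..N} - {i})"
      by (auto simp: H j v heap_entry_def)
    also have "\<dots> = (\<lambda>a. heap_entry p a (k' a + 1)) ` ({1..N} - {i})"
      by (intro image_cong) (auto simp: k'_def)
    finally have "insert (heap_entry p i (k' i + 1)) (H - {(i, j, v)})
        = (\<lambda>a. heap_entry p a (k' a + 1)) ` insert i ({1..N} - {i})"
      by (simp only: image_insert)
    moreover have "k' i = j" by (simp add: k'_def)
    ultimately show ?thesis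
      unfolding insert_Diff[OF i] by (simp only:)
  qed
  moreover have "(\<Prod>r = 1..k' i' + 1. p i' r) \<le> (\<Prod>r = 1..t. p a r)"
    if "(a, t) \<in> insert (i, j) S" and i': "i' \<in> {1..N}" for a t i'
  proof -
    \<comment> \<open>Only the frontier of the popped request moves, from \<open>k i + 1\<close> to
      \<open>k i + 2\<close>; all others stay.\<close>
    have "(\<Prod>r = 1..k' i' + 1. p i' r) \<le> (\<Prod>r = 1..k i' + 1. p i' r)"
      using p i' by (intro prod_unit_interval_antimono) (auto simp: k'_def j)
    also have "\<dots> \<le> (\<Prod>r = 1..t. p a r)"
      using that dom popped_max v by auto
    finally show ?thesis .
  qed
  ultimately show ?case
    by (intro exI[of _ k'] conjI) auto
qed

text \<open>An unselected token lies at or beyond the frontier of its request, so its product is at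
  most the frontier product, which the loop invariant already bounds. The argument covers every way
  of breaking ties.\<close>

lemma tetris_output_dominant:
  assumes "tetris_output p N C S" and p: "\<And>i j. i \<in> {1..N} \<Longrightarrow> p i j \<in> {0..1::real}"
  shows "feasible_selection N C S"
    and "\<And>i t i' t'. (i, t) \<in> S \<Longrightarrow> (i', t') \<notin> S \<Longrightarrow> i' \<in> {1..N} \<Longrightarrow> 1 \<le> t' \<Longrightarrow>
      (\<Prod>r = 1..t'. p i' r) \<le> (\<Prod>r = 1..t. p i r)"
proof -
  obtain H where "tetris_state p N C S H" and card: "card S = C"
    using assms(1) by (auto simp: tetris_output_def)
  from tetris_state_invariant[OF this(1) p] obtain k where S: "S = prefix_selection N k"
    and dom: "\<And>i t i'. (i, t) \<in> S \<Longrightarrow> i' \<in> {1..N} \<Longrightarrow>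
      (\<Prod>r = 1..k i' + 1. p i' r) \<le> (\<Prod>r = 1..t. p i r)"
    by blast
  show "feasible_selection N C S"
    using S card by (auto simp: feasible_selection_def card_prefix_selection)
  fix i t i' t'
  assume it: "(i, t) \<in> S" and "(i', t') \<notin> S" and i': "i' \<in> {1..N}" and "1 \<le> t'"
  then have "k i' + 1 \<le> t'"
    by (auto simp: S prefix_selection_def)
  then have "(\<Prod>r = 1..t'. p i' r) \<le> (\<Prod>r = 1..k i' + 1. p i' r)"
    using p i' by (intro prod_unit_interval_antimono)
  also have "\<dots> \<le> (\<Prod>r = 1..t. p i r)"
    using dom it i' .
  finally show "(\<Prod>r = 1..t'. p i' r) \<le> (\<Prod>r = 1..t. p i r)" .
qed

section \<open>TETRIS and batched decoding as strategies\<close>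

lemma tetris_strategy_imp_strategy:
  assumes "tetris_strategy F p N C T D" and "\<And>i j. i \<in> {1..N} \<Longrightarrow> p i j \<in> {0..1::real}"
  shows "strategy F N C T D"
  unfolding strategy_def
proof
  fix s assume "s \<in> {1..T}"
  then have D: "D s \<in> F s \<rightarrow>\<^sub>M count_space {S. tetris_output p N C S}"
    using assms(1) by (simp add: tetris_strategy_def)
  \<comment> \<open>Between discrete spaces the inclusion is measurable once it maps into the
    target, so feasibility of the outputs is all that is required.\<close>
  have "(\<lambda>S. S) \<in> count_space {S. tetris_output p N C S} \<rightarrow>\<^sub>M count_space {S. feasible_selection N C S}"
    using tetris_output_dominant(1)[OF _ assms(2)] by (auto simp: measurable_count_space_eq1)
  from measurable_compose[OF D this]
  show "D s \<in> F s \<rightarrow>\<^sub>M count_space {S. feasible_selection N C S}" .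
qed

lemma batched_strategy_is_strategy:
  assumes "N * k = C"
  shows "strategy F N C T (batched_strategy N k)"
proof -
  have "feasible_selection N C (prefix_selection N (\<lambda>i. k))"
    unfolding feasible_selection_def using assms by (intro exI[of _ "\<lambda>i. k"]) simp
  then show ?thesis
    by (simp add: strategy_def batched_strategy_def)
qed

section \<open>Expected number of accepted tokens\<close>

context draft_model
begin

lemma space_F: "space (F s) = space M"
  using information[of s] unfolding subalgebra_def by (rule conjunct1)

lemma sets_F: "A \<in> sets (F s) \<Longrightarrow> A \<in> events"
  using information[of s] unfolding subalgebra_def by blast

lemma acc_events:
  assumes "s \<in> {1..T}" "i \<in> {1..N}" "1 \<le> t"
  shows "{\<omega>\<in>space M. acc s i t \<omega>} \<in> events"
  using acc_known[OF assms] unfolding pred_def space_F by (rule sets_F)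

text \<open>Chain rule along the positions: each further token contributes its conditional
  acceptance rate. Keeping \<open>A\<close> arbitrary in \<open>F s\<close> allows it to be, later
  on, the event that a token is selected.\<close>

lemma prob_acc_upto:
  assumes s: "s \<in> {1..T}" and i: "i \<in> {1..N}" and A: "A \<in> sets (F s)"
  shows "\<P>(\<omega> in M. \<omega> \<in> A \<and> (\<forall>r\<in>{1..t}. acc s i r \<omega>)) = prob A * (\<Prod>r = 1..t. rate s i r)"
proof (induction t)
  case 0
  have "{\<omega>\<in>space M. \<omega> \<in> A} = A"
    using sets.sets_into_space[OF A] by (auto simp: space_F)
  then show ?case by simp
next
  case (Suc t)
  define B where "B = {\<omega>\<in>space M. \<omega> \<in> A \<and> (\<forall>r\<in>{1..<Suc t}. acc s i r \<omega>)}"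
  have B: "prob B = prob A * (\<Prod>r = 1..t. rate s i r)"
    using Suc by (simp add: B_def atLeastLessThanSuc_atLeastAtMost)
  have goal_set: "{\<omega>\<in>space M. \<omega> \<in> A \<and> (\<forall>r\<in>{1..Suc t}. acc s i r \<omega>)}
      = {\<omega>\<in>space M. acc s i (Suc t) \<omega> \<and> \<omega> \<in> A \<and> (\<forall>r\<in>{1..<Suc t}. acc s i r \<omega>)}"
    by (auto simp: atLeastAtMostSuc_conv less_Suc_eq_le)
  have B_event: "B \<in> events"
  proof -
    have [measurable]: "Measurable.pred M (\<lambda>\<omega>. \<omega> \<in> A)"
      using sets_F[OF A] by measurable
    have [measurable]: "Measurable.pred M (acc s i r)" if "r \<in> {1..<Suc t}" for r
      using acc_events[OF s i, of r] that by (simp add: pred_def)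
    show ?thesis unfolding B_def by measurable
  qed
  show ?case
  proof (cases "prob B > 0")
    case True
    then have "\<P>(\<omega> in M. acc s i (Suc t) \<omega> \<bar> \<omega> \<in> A \<and> (\<forall>r\<in>{1..<Suc t}. acc s i r \<omega>)) = rate s i (Suc t)"
      unfolding B_def by (intro acceptance s i A) auto
    then have "\<P>(\<omega> in M. \<omega> \<in> A \<and> (\<forall>r\<in>{1..Suc t}. acc s i r \<omega>)) = rate s i (Suc t) * prob B"
      using True unfolding cond_prob_def goal_set B_def by (simp add: field_simps)
    then show ?thesis by (simp add: B)
  next
    \<comment> \<open>On a null event the conditional probability is 0 by convention and
      \<open>acceptance\<close> says nothing; here both sides of the product formula vanish.\<close>
    case False
    then have "prob B = 0"
      using measure_nonneg[of M B] by linarith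
    moreover have "\<P>(\<omega> in M. \<omega> \<in> A \<and> (\<forall>r\<in>{1..Suc t}. acc s i r \<omega>)) \<le> prob B"
      by (rule finite_measure_mono[OF _ B_event]) (auto simp: B_def)
    ultimately have "\<P>(\<omega> in M. \<omega> \<in> A \<and> (\<forall>r\<in>{1..Suc t}. acc s i r \<omega>)) = prob B * rate s i (Suc t)"
      by (simp add: measure_le_0_iff)
    then show ?thesis by (simp add: B)
  qed
qed

text \<open>By \<open>acc_prefix\<close>, acceptance at position \<open>t\<close> is the same event
  as acceptance at all positions up to \<open>t\<close>.\<close>

lemma prob_acc:
  assumes "s \<in> {1..T}" "i \<in> {1..N}" "1 \<le> t" "A \<in> sets (F s)"
  shows "\<P>(\<omega> in M. \<omega> \<in> A \<and> acc s i t \<omega>) = prob A * (\<Prod>r = 1..t. rate s i r)"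
proof -
  have "{\<omega>\<in>space M. \<omega> \<in> A \<and> acc s i t \<omega>} = {\<omega>\<in>space M. \<omega> \<in> A \<and> (\<forall>r\<in>{1..t}. acc s i r \<omega>)}"
    using assms(3) acc_prefix[OF assms(1,2)] by auto
  then show ?thesis using prob_acc_upto[OF assms(1,2,4)] by simp
qed

lemma selected_in_F:
  assumes "strategy F N C T D" "s \<in> {1..T}"
  shows "{\<omega>\<in>space M. x \<in> D s \<omega>} \<in> sets (F s)"
proof -
  have D: "D s \<in> F s \<rightarrow>\<^sub>M count_space {S. feasible_selection N C S}"
    using assms by (simp add: strategy_def)
  \<comment> \<open>The preimage is taken of a subset of the target space; restricting to feasible
    sets loses nothing because \<open>D s\<close> takes no other values on
    \<open>space M\<close>.\<close>
  have "D s -` {S. feasible_selection N C S \<and> x \<in> S} \<inter> space (F s) \<in> sets (F s)"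
    by (rule measurable_sets[OF D]) auto
  moreover have "D s -` {S. feasible_selection N C S \<and> x \<in> S} \<inter> space (F s)
      = {\<omega>\<in>space M. x \<in> D s \<omega>}"
    using measurable_space[OF D] by (auto simp: space_F)
  ultimately show ?thesis by simp
qed

lemma strategy_feasible:
  assumes "strategy F N C T D" "s \<in> {1..T}" "\<omega> \<in> space M"
  shows "feasible_selection N C (D s \<omega>)"
proof -
  have "D s \<in> F s \<rightarrow>\<^sub>M count_space {S. feasible_selection N C S}"
    using assms by (simp add: strategy_def)
  from measurable_space[OF this, of \<omega>] show ?thesis
    using assms(3) by (simp add: space_F)
qed

text \<open>Indicators of the selection events turn the random index set into the fixed box, after
  which linearity applies. The summand \<open>f\<close> is general so that acceptance indicators and
  deterministic weights can both be inserted.\<close>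

lemma expectation_sum_selected:
  fixes f :: "nat \<times> nat \<Rightarrow> 'w \<Rightarrow> real"
  assumes D: "strategy F N C T D" and s: "s \<in> {1..T}"
    and f: "\<And>x. x \<in> {1..N} \<times> {1..C} \<Longrightarrow> integrable M (f x)"
  shows "integrable M (\<lambda>\<omega>. \<Sum>x\<in>D s \<omega>. f x \<omega>)" (is ?int)
    and "expectation (\<lambda>\<omega>. \<Sum>x\<in>D s \<omega>. f x \<omega>)
      = (\<Sum>x\<in>{1..N} \<times> {1..C}. expectation (\<lambda>\<omega>. f x \<omega> * indicator {\<omega>\<in>space M. x \<in> D s \<omega>} \<omega>))" (is ?exp)
proof -
  define g where "g x \<omega> = f x \<omega> * indicator {\<omega>\<in>space M. x \<in> D s \<omega>} \<omega>" for x \<omega>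
  have eq: "(\<Sum>x\<in>D s \<omega>. f x \<omega>) = (\<Sum>x\<in>{1..N} \<times> {1..C}. g x \<omega>)" if "\<omega> \<in> space M" for \<omega>
    unfolding g_def using feasible_selection_subset[OF strategy_feasible[OF D s that]] that
    by (intro sum.mono_neutral_cong_left) auto
  have g: "integrable M (g x)" if "x \<in> {1..N} \<times> {1..C}" for x
    unfolding g_def using f[OF that] sets_F[OF selected_in_F[OF D s]]
    by (intro integrable_real_mult_indicator) auto
  have "integrable M (\<lambda>\<omega>. \<Sum>x\<in>{1..N} \<times> {1..C}. g x \<omega>)"
    by (intro Bochner_Integration.integrable_sum g)
  then show ?int
    by (subst Bochner_Integration.integrable_cong[OF refl eq])
  have "expectation (\<lambda>\<omega>. \<Sum>x\<in>D s \<omega>. f x \<omega>) = expectation (\<lambda>\<omega>. \<Sum>x\<in>{1..N} \<times> {1..C}. g x \<omega>)"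
    by (intro Bochner_Integration.integral_cong refl eq)
  also have "\<dots> = (\<Sum>x\<in>{1..N} \<times> {1..C}. expectation (g x))"
    by (intro Bochner_Integration.integral_sum g)
  finally show ?exp unfolding g_def .
qed

lemma expectation_accepted:
  assumes D: "strategy F N C T D" and s: "s \<in> {1..T}"
  shows "expectation (\<lambda>\<omega>. \<Sum>(i, t)\<in>D s \<omega>. of_bool (acc s i t \<omega>))
    = expectation (\<lambda>\<omega>. \<Sum>(i, t)\<in>D s \<omega>. \<Prod>r = 1..t. rate s i r)"
proof -
  \<comment> \<open>\<open>w\<close> is constant in the outcome but takes it as an argument, to have
    the same shape as \<open>a\<close>.\<close>
  define a :: "nat \<times> nat \<Rightarrow> 'w \<Rightarrow> real" where "a = (\<lambda>(i, t) \<omega>. of_bool (acc s i t \<omega>))"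
  define w :: "nat \<times> nat \<Rightarrow> 'w \<Rightarrow> real" where "w = (\<lambda>(i, t) \<omega>. \<Prod>r = 1..t. rate s i r)"
  have int_a: "integrable M (a x)" if x_in: "x \<in> {1..N} \<times> {1..C}" for x
  proof -
    obtain i t where x: "x = (i, t)" "i \<in> {1..N}" "1 \<le> t"
      using x_in by (cases x) auto
    have "integrable M (indicator {\<omega>\<in>space M. acc s i t \<omega>} :: 'w \<Rightarrow> real)"
      using acc_events[OF s x(2,3)] by (intro integrable_real_indicator) (auto simp: less_top[symmetric])
    then show ?thesis
      by (subst Bochner_Integration.integrable_cong[OF refl])
        (auto simp: a_def x(1) indicator_def)
  qed
  have int_w: "integrable M (w x)" for x
    by (auto simp: w_def split: prod.split)
  have "expectation (\<lambda>\<omega>. a x \<omega> * indicator {\<omega>\<in>space M. x \<in> D s \<omega>} \<omega>)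
      = expectation (\<lambda>\<omega>. w x \<omega> * indicator {\<omega>\<in>space M. x \<in> D s \<omega>} \<omega>)"
    if x_in: "x \<in> {1..N} \<times> {1..C}" for x
  proof -
    obtain i t where x: "x = (i, t)" "i \<in> {1..N}" "1 \<le> t"
      using x_in by (cases x) auto
    \<comment> \<open>Selection of \<open>x\<close> is decided by \<open>F s\<close>, hence
      \<open>prob_acc\<close> applies with this \<open>A\<close>, and both expectations equal
      \<open>prob A\<close> times the product of the rates.\<close>
    define A where "A = {\<omega>\<in>space M. x \<in> D s \<omega>}"
    have A: "A \<in> sets (F s)"
      unfolding A_def by (rule selected_in_F[OF D s])
    have "expectation (\<lambda>\<omega>. a x \<omega> * indicator A \<omega>)
        = expectation (indicator {\<omega>\<in>space M. \<omega> \<in> A \<and> acc s i t \<omega>})"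
      by (intro Bochner_Integration.integral_cong) (auto simp: a_def x(1) indicator_def)
    also have "\<dots> = \<P>(\<omega> in M. \<omega> \<in> A \<and> acc s i t \<omega>)"
      by (simp add: Int_absorb2 subset_eq)
    also have "\<dots> = prob A * (\<Prod>r = 1..t. rate s i r)"
      by (rule prob_acc[OF s x(2,3) A])
    also have "\<dots> = expectation (\<lambda>\<omega>. w x \<omega> * indicator A \<omega>)"
      using sets_F[OF A] by (simp add: w_def x(1))
    finally show ?thesis by (simp add: A_def)
  qed
  then have "expectation (\<lambda>\<omega>. \<Sum>x\<in>D s \<omega>. a x \<omega>) = expectation (\<lambda>\<omega>. \<Sum>x\<in>D s \<omega>. w x \<omega>)"
    using expectation_sum_selected(2)[OF D s int_a] expectation_sum_selected(2)[OF D s int_w]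
    by simp
  then show ?thesis by (simp add: a_def w_def case_prod_unfold)
qed

text \<open>Once accepted tokens are replaced by their weights through
  \<open>expectation_accepted\<close>, an outcomewise comparison of selections passes to
  expectations, steps and the average.\<close>

lemma total_throughput_mono:
  assumes D: "strategy F N C T D" and D': "strategy F N C T D'" and "\<tau> \<ge> 0"
    and le: "\<And>s \<omega>. s \<in> {1..T} \<Longrightarrow> \<omega> \<in> space M \<Longrightarrow>
      (\<Sum>(i, t)\<in>D' s \<omega>. \<Prod>r = 1..t. rate s i r) \<le> (\<Sum>(i, t)\<in>D s \<omega>. \<Prod>r = 1..t. rate s i r)"
  shows "total_throughput M acc N T \<tau> D' \<le> total_throughput M acc N T \<tau> D"
proof -
  have "step_throughput M acc N \<tau> D' s \<le> step_throughput M acc N \<tau> D s" if s: "s \<in> {1..T}" for s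
  proof -
    have int: "integrable M (\<lambda>\<omega>. \<Sum>(i, t)\<in>E s \<omega>. \<Prod>r = 1..t. rate s i r)"
      if "strategy F N C T E" for E
      by (rule expectation_sum_selected(1)[OF that s]) (auto split: prod.split)
    have "expectation (\<lambda>\<omega>. \<Sum>(i, t)\<in>D' s \<omega>. \<Prod>r = 1..t. rate s i r)
        \<le> expectation (\<lambda>\<omega>. \<Sum>(i, t)\<in>D s \<omega>. \<Prod>r = 1..t. rate s i r)"
      by (intro integral_mono int D D' le s)
    then show ?thesis
      unfolding step_throughput_def expectation_accepted[OF D s] expectation_accepted[OF D' s]
      using \<open>\<tau> \<ge> 0\<close> by (intro divide_right_mono) auto
  qed
  then show ?thesis
    unfolding total_throughput_def by (intro divide_right_mono sum_mono) auto
qed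

end

section \<open>Optimality of TETRIS and the case of equal rates\<close>

theorem theorem2:
  fixes M :: "'w measure" and F :: "nat \<Rightarrow> 'w measure"
    and acc :: "nat \<Rightarrow> nat \<Rightarrow> nat \<Rightarrow> 'w \<Rightarrow> bool"
    and N C T :: nat and \<alpha> :: "nat \<Rightarrow> real" and \<tau> :: real
    and D :: "nat \<Rightarrow> 'w \<Rightarrow> selection"
  assumes "N \<ge> 1" and "C \<ge> 1" and "T \<ge> 1"
    and "\<forall>i\<in>{1..N}. \<alpha> i \<in> {0..1}"
    and "draft_model M F acc N T (\<lambda>s i t. \<alpha> i)"
    and "\<tau> > 0"
    and "tetris_strategy F (\<lambda>i j. \<alpha> i) N C T D"
  shows "(strategy F N C T D \<and>
          (\<forall>D'. strategy F N C T D' \<longrightarrow>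
             total_throughput M acc N T \<tau> D' \<le> total_throughput M acc N T \<tau> D)) \<and>
         ((\<forall>i\<in>{1..N}. \<forall>j\<in>{1..N}. \<alpha> i = \<alpha> j) \<longrightarrow>
          (\<forall>k. N * k = C \<longrightarrow>
             total_throughput M acc N T \<tau> D = total_throughput M acc N T \<tau> (batched_strategy N k)))"
proof -
  interpret draft_model M F acc N T "\<lambda>s i t. \<alpha> i"
    by (rule assms(5))
  define w where "w = (\<lambda>(i, t). \<alpha> i ^ t)"
  have rates: "i \<in> {1..N} \<Longrightarrow> \<alpha> i \<in> {0..1}" for i
    using assms(4) by blast
  have D: "strategy F N C T D"
    by (rule tetris_strategy_imp_strategy[OF assms(7)]) (rule rates)
  \<comment> \<open>The target space of the measurability condition forces an output of the
    algorithm at every outcome, not merely almost surely.\<close>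
  have tetris: "tetris_output (\<lambda>i j. \<alpha> i) N C (D s \<omega>)" if "s \<in> {1..T}" "\<omega> \<in> space M" for s \<omega>
    using assms(7) that
      measurable_space[of "D s" "F s" "count_space {S. tetris_output (\<lambda>i j. \<alpha> i) N C S}" \<omega>]
    by (auto simp: tetris_strategy_def space_F)
  \<comment> \<open>The exchange argument lifted to strategies. It is used in both directions: with
    \<open>E\<close> as TETRIS against any competitor, and with \<open>E\<close> as batched decoding
    against TETRIS.\<close>
  have compare: "total_throughput M acc N T \<tau> E' \<le> total_throughput M acc N T \<tau> E"
    if E: "strategy F N C T E" and E': "strategy F N C T E'"
      and dom: "\<And>s \<omega> x y. s \<in> {1..T} \<Longrightarrow> \<omega> \<in> space M \<Longrightarrow> x \<in> E s \<omega> \<Longrightarrow> y \<notin> E s \<omega> \<Longrightarrow>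
        y \<in> {1..N} \<times> {1..C} \<Longrightarrow> w y \<le> w x" for E E'
  proof (rule total_throughput_mono[OF E E'])
    fix s \<omega> assume *: "s \<in> {1..T}" "\<omega> \<in> space M"
    note feasible = strategy_feasible[OF E *] strategy_feasible[OF E' *]
    have "sum w (E' s \<omega>) \<le> sum w (E s \<omega>)"
      using feasible[THEN feasible_selection_finite] feasible[THEN feasible_selection_card]
        feasible_selection_subset[OF feasible(2)] dom[OF *]
      by (intro sum_le_sum_of_dominant) auto
    then show "(\<Sum>(i, t)\<in>E' s \<omega>. \<Prod>r = 1..t. \<alpha> i) \<le> (\<Sum>(i, t)\<in>E s \<omega>. \<Prod>r = 1..t. \<alpha> i)"
      by (simp add: w_def)
  qed (use \<open>\<tau> > 0\<close> in simp)
  have optimal: "total_throughput M acc N T \<tau> D' \<le> total_throughput M acc N T \<tau> D"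
    if "strategy F N C T D'" for D'
  proof (rule compare[OF D that])
    fix s \<omega> x y
    assume *: "s \<in> {1..T}" "\<omega> \<in> space M" "x \<in> D s \<omega>" "y \<notin> D s \<omega>" "y \<in> {1..N} \<times> {1..C}"
    obtain i t i' t' where xy: "x = (i, t)" "y = (i', t')"
      by fastforce
    have "(\<Prod>r = 1..t'. \<alpha> i') \<le> (\<Prod>r = 1..t. \<alpha> i)"
      using * by (intro tetris_output_dominant(2)[OF tetris[OF *(1,2)]] rates) (auto simp: xy)
    then show "w y \<le> w x" by (simp add: w_def xy)
  qed
  have "total_throughput M acc N T \<tau> D = total_throughput M acc N T \<tau> (batched_strategy N k)"
    if eq: "\<forall>i\<in>{1..N}. \<forall>j\<in>{1..N}. \<alpha> i = \<alpha> j" and k: "N * k = C" for k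
  \<comment> \<open>One inequality is the optimality of TETRIS; for the other, the batched selection
    is shown to satisfy the same domination condition.\<close>
  proof (rule antisym)
    note batched = batched_strategy_is_strategy[OF k, of F T]
    show "total_throughput M acc N T \<tau> (batched_strategy N k) \<le> total_throughput M acc N T \<tau> D"
      by (rule optimal[OF batched])
    show "total_throughput M acc N T \<tau> D \<le> total_throughput M acc N T \<tau> (batched_strategy N k)"
    proof (rule compare[OF batched D])
      fix s x y and \<omega> :: 'w
      assume *: "x \<in> batched_strategy N k s \<omega>" "y \<notin> batched_strategy N k s \<omega>"
        "y \<in> {1..N} \<times> {1..C}"
      obtain i t i' t' where xy: "x = (i, t)" "y = (i', t')"
        by fastforce
      \<comment> \<open>A selected position is at most \<open>k\<close> and an omitted one exceeds
        \<open>k\<close>, whatever the requests. With a common rate, the weight depends on the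
        position alone and decreases weakly in it.\<close>
      have ii': "i \<in> {1..N}" "i' \<in> {1..N}" and "t \<le> t'"
        using * by (auto simp: xy batched_strategy_def prefix_selection_def)
      then have "\<alpha> i ^ t' \<le> \<alpha> i ^ t"
        using rates[of i] by (intro power_decreasing) auto
      moreover have "\<alpha> i' = \<alpha> i"
        using eq ii' by blast
      ultimately show "w y \<le> w x" by (simp add: w_def xy)
    qed
  qed
  with D optimal show ?thesis by blast
qed

end
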